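(* Let $0<\gamma<1$ and let $\mathcal E$ be the single-qubit amplitude damping operation $\mathcal E(\rho)=A_0\rho A_0^\dagger+A_1\rho A_1^\dagger$ with $$A_0=\begin{bmatrix}1&0\\0&\sqrt{1-\gamma}\end{bmatrix},\qquad A_1=\begin{bmatrix}0&\sqrt\gamma\\0&0\end{bmatrix}.$$ Let $\mathcal C\subset(\mathbb C^2)^{\otimes4}$ be the two-dimensional code spanned by $$|0_L\rangle=\tfrac1{\sqrt2}(|0000\rangle+|1111\rangle),\qquad |1_L\rangle=\tfrac1{\sqrt2}(|0011\rangle+|1100\rangle).$$ Then, for all sufficiently small $\gamma$, there is a trace-preserving quantum operation $\mathcal R$ on four qubits such that for every unit vector $|\psi\rangle\in\mathcal C$, $$\langle\psi|\,\mathcal R\big(\mathcal E^{\otimes4}(|\psi\rangle\langle\psi|)\big)\,|\psi\rangle\ \ge\ 1-3\gamma^2 .$$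
   Context: A trace-preserving quantum operation is a completely positive trace-preserving linear map on operators. $\mathcal E^{\otimes 4}$ denotes independent amplitude damping of each of the four qubits. *)

theory Defs
  imports "HOL-Analysis.Analysis"
begin

text \<open>
  The index type \<^typ>\<open>bool\<close> labels the computational basis of a qubit
  (\<^const>\<open>False\<close> for 0, \<^const>\<open>True\<close> for 1), and product index types label tensor products.
  The order on \<^typ>\<open>complex\<close> is that of Complex Order: \<open>x \<le> y\<close> means
  \<open>Re x \<le> Re y\<close> and \<open>Im x = Im y\<close>, so \<open>0 \<le> z\<close> includes that \<open>z\<close> is real.
\<close>

type_synonym 'n operator = "complex ^ 'n ^ 'n"

type_synonym qubits4 = "bool \<times> bool \<times> bool \<times> bool"

definition cscale :: "complex \<Rightarrow> complex ^ 'n ^ 'm \<Rightarrow> complex ^ 'n ^ 'm" where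
  "cscale c A = map_matrix ((*) c) A"

definition adjoint :: "complex ^ 'n ^ 'm \<Rightarrow> complex ^ 'm ^ 'n" where
  "adjoint A = map_matrix cnj (transpose A)"

definition braket :: "complex ^ 'n \<Rightarrow> complex ^ 'n \<Rightarrow> complex" where
  "braket x y = (\<Sum>i\<in>UNIV. cnj (x $ i) * y $ i)"

definition ketbra :: "complex ^ 'n \<Rightarrow> complex ^ 'm \<Rightarrow> complex ^ 'm ^ 'n" where
  "ketbra x y = (\<chi> i j. x $ i * cnj (y $ j))"

abbreviation ket :: "'n::finite \<Rightarrow> complex ^ 'n" where
  "ket i \<equiv> axis i 1"

definition complex_linear ::
    "(complex ^ 'n ^ 'n \<Rightarrow> complex ^ 'm ^ 'm) \<Rightarrow> bool" where
  "complex_linear \<Phi> \<longleftrightarrow> Vector_Spaces.linear cscale cscale \<Phi>"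

text \<open>
  A family \<open>X i j\<close> with \<open>i, j < k\<close> is read as the block matrix of an operator on the
  tensor product of a \<open>k\<close>-dimensional ancilla with the system. Applying \<open>\<Phi>\<close> to each block is
  the action of the identity map on the ancilla tensored with \<open>\<Phi>\<close>. Using blocks allows \<open>k\<close> to
  range over all natural numbers inside the definition of complete positivity.
\<close>

definition block_positive :: "nat \<Rightarrow> (nat \<Rightarrow> nat \<Rightarrow> 'n::finite operator) \<Rightarrow> bool" where
  "block_positive k X \<longleftrightarrow>
     (\<forall>v :: nat \<Rightarrow> complex ^ 'n. 0 \<le> (\<Sum>i<k. \<Sum>j<k. braket (v i) (X i j *v v j)))"

definition completely_positive :: "('n::finite operator \<Rightarrow> 'm::finite operator) \<Rightarrow> bool" where
  "completely_positive \<Phi> \<longleftrightarrow>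
     (\<forall>k X. block_positive k X \<longrightarrow> block_positive k (\<lambda>i j. \<Phi> (X i j)))"

definition trace_preserving :: "('n::finite operator \<Rightarrow> 'm::finite operator) \<Rightarrow> bool" where
  "trace_preserving \<Phi> \<longleftrightarrow> (\<forall>A. trace (\<Phi> A) = trace A)"

definition tp_quantum_operation :: "('n::finite operator \<Rightarrow> 'm::finite operator) \<Rightarrow> bool" where
  "tp_quantum_operation \<Phi> \<longleftrightarrow>
     complex_linear \<Phi> \<and> completely_positive \<Phi> \<and> trace_preserving \<Phi>"

definition tensor_op :: "'a::finite operator \<Rightarrow> 'b::finite operator \<Rightarrow> ('a \<times> 'b) operator" where
  "tensor_op A B = (\<chi> p q. A $ fst p $ fst q * B $ snd p $ snd q)"

text \<open>
  The tensor product of two linear maps on operators, obtained by expanding the argument in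
  products of matrix units; see \<open>tensor_map_tensor_op\<close> for its characteristic property.
\<close>

definition tensor_map ::
    "('a::finite operator \<Rightarrow> 'c::finite operator) \<Rightarrow> ('b::finite operator \<Rightarrow> 'd::finite operator) \<Rightarrow>
     ('a \<times> 'b) operator \<Rightarrow> ('c \<times> 'd) operator" where
  "tensor_map \<Phi> \<Psi> X =
     (\<Sum>p\<in>UNIV. \<Sum>q\<in>UNIV. cscale (X $ p $ q)
        (tensor_op (\<Phi> (ketbra (ket (fst p)) (ket (fst q))))
                   (\<Psi> (ketbra (ket (snd p)) (ket (snd q))))))"

definition qubit_matrix :: "complex \<Rightarrow> complex \<Rightarrow> complex \<Rightarrow> complex \<Rightarrow> bool operator" where
  "qubit_matrix a b c d =
     (\<chi> i j. if i then (if j then d else c) else (if j then b else a))"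

definition damp_A0 :: "real \<Rightarrow> bool operator" where
  "damp_A0 \<gamma> = qubit_matrix 1 0
                             0 (complex_of_real (sqrt (1 - \<gamma>)))"

definition damp_A1 :: "real \<Rightarrow> bool operator" where
  "damp_A1 \<gamma> = qubit_matrix 0 (complex_of_real (sqrt \<gamma>))
                             0 0"

definition amp_damp :: "real \<Rightarrow> bool operator \<Rightarrow> bool operator" where
  "amp_damp \<gamma> \<rho> =
     damp_A0 \<gamma> ** \<rho> ** adjoint (damp_A0 \<gamma>) + damp_A1 \<gamma> ** \<rho> ** adjoint (damp_A1 \<gamma>)"

definition amp_damp4 :: "real \<Rightarrow> qubits4 operator \<Rightarrow> qubits4 operator" where
  "amp_damp4 \<gamma> =
     tensor_map (amp_damp \<gamma>) (tensor_map (amp_damp \<gamma>) (tensor_map (amp_damp \<gamma>) (amp_damp \<gamma>)))"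

definition zero_L :: "complex ^ qubits4" where
  "zero_L = complex_of_real (1 / sqrt 2) *s
     (ket (False, False, False, False) + ket (True, True, True, True))"

definition one_L :: "complex ^ qubits4" where
  "one_L = complex_of_real (1 / sqrt 2) *s
     (ket (False, False, True, True) + ket (True, True, False, False))"

definition damping_code :: "(complex ^ qubits4) set" where
  "damping_code = vec.span {zero_L, one_L}"

lemma vector_space_cscale: "vector_space cscale"
  by standard (simp_all add: cscale_def map_matrix_def vec_eq_iff algebra_simps)

lemma operator_expand:
  "(\<Sum>i\<in>UNIV. \<Sum>j\<in>UNIV. cscale (A $ i $ j) (ketbra (ket i) (ket j))) = (A :: 'n::finite operator)"
proof -
  have "(\<Sum>i\<in>UNIV. \<Sum>j\<in>UNIV. cscale (A $ i $ j) (ketbra (ket i) (ket j))) $ a $ b = A $ a $ b" for a b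
  proof -
    have "(\<Sum>i\<in>UNIV. \<Sum>j\<in>UNIV. cscale (A $ i $ j) (ketbra (ket i) (ket j))) $ a $ b
        = (\<Sum>i\<in>UNIV. \<Sum>j\<in>UNIV. if b = j then (if a = i then A $ i $ j else 0) else 0)"
      unfolding sum_component by (intro sum.cong refl) (auto simp: cscale_def ketbra_def axis_def)
    thus ?thesis by simp
  qed
  thus ?thesis by (simp add: vec_eq_iff)
qed

lemma complex_linear_expand:
  fixes \<Phi> :: "'n::finite operator \<Rightarrow> 'm::finite operator"
  assumes "complex_linear \<Phi>"
  shows "\<Phi> A = (\<Sum>i\<in>UNIV. \<Sum>j\<in>UNIV. cscale (A $ i $ j) (\<Phi> (ketbra (ket i) (ket j))))"
proof -
  interpret Vector_Spaces.linear cscale cscale \<Phi>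
    using assms by (simp add: complex_linear_def)
  have "\<Phi> A = \<Phi> (\<Sum>i\<in>UNIV. \<Sum>j\<in>UNIV. cscale (A $ i $ j) (ketbra (ket i) (ket j)))"
    by (simp only: operator_expand)
  also have "\<dots> = (\<Sum>i\<in>UNIV. \<Sum>j\<in>UNIV. cscale (A $ i $ j) (\<Phi> (ketbra (ket i) (ket j))))"
    by (simp only: sum scale)
  finally show ?thesis .
qed

lemma complex_linear_expand_nth:
  fixes \<Phi> :: "'n::finite operator \<Rightarrow> 'm::finite operator"
  assumes "complex_linear \<Phi>"
  shows "\<Phi> A $ a $ b =
    (\<Sum>i\<in>UNIV. \<Sum>j\<in>UNIV. A $ i $ j * \<Phi> (ketbra (ket i) (ket j)) $ a $ b)"
  using arg_cong[OF complex_linear_expand[OF assms, of A], of "\<lambda>M. M $ a $ b"]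
  by (simp add: cscale_def)

lemma tensor_map_tensor_op:
  fixes \<Phi> :: "'a::finite operator \<Rightarrow> 'c::finite operator"
    and \<Psi> :: "'b::finite operator \<Rightarrow> 'd::finite operator"
  assumes "complex_linear \<Phi>" "complex_linear \<Psi>"
  shows "tensor_map \<Phi> \<Psi> (tensor_op A B) = tensor_op (\<Phi> A) (\<Psi> B)"
proof -
  have "tensor_map \<Phi> \<Psi> (tensor_op A B) $ p $ q = tensor_op (\<Phi> A) (\<Psi> B) $ p $ q" for p q
  proof -
    let ?F = "\<lambda>i k. A $ i $ k * \<Phi> (ketbra (ket i) (ket k)) $ fst p $ fst q"
    let ?G = "\<lambda>j l. B $ j $ l * \<Psi> (ketbra (ket j) (ket l)) $ snd p $ snd q"
    have "tensor_map \<Phi> \<Psi> (tensor_op A B) $ p $ q =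
        (\<Sum>x\<in>UNIV. \<Sum>y\<in>UNIV. ?F (fst x) (fst y) * ?G (snd x) (snd y))"
      by (simp add: tensor_map_def tensor_op_def cscale_def mult_ac)
    also have "\<dots> = (\<Sum>i\<in>UNIV. \<Sum>j\<in>UNIV. \<Sum>k\<in>UNIV. \<Sum>l\<in>UNIV. ?F i k * ?G j l)"
      by (simp only: UNIV_Times_UNIV[symmetric] sum.cartesian_product' fst_conv snd_conv)
    also have "\<dots> = (\<Sum>i\<in>UNIV. \<Sum>k\<in>UNIV. ?F i k) * (\<Sum>j\<in>UNIV. \<Sum>l\<in>UNIV. ?G j l)"
      by (simp only: sum_product)
    also have "\<dots> = tensor_op (\<Phi> A) (\<Psi> B) $ p $ q"
      unfolding complex_linear_expand_nth[OF assms(1), of A, symmetric] complex_linear_expand_nth[OF assms(2), of B, symmetric]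
      by (simp add: tensor_op_def)
    finally show ?thesis .
  qed
  thus ?thesis by (simp add: vec_eq_iff)
qed

end

theory Submission
  imports Defs
begin

text \<open>
  Label a Kraus operator \<open>E\<^sub>m\<close> of the fourfold damping by its pattern \<open>m\<close> of damped qubits. The
  recovery projects onto the code when \<open>m\<close> is empty, and the images of \<open>0\<^sub>L\<close> and \<open>1\<^sub>L\<close> under a
  single damping are distinct basis vectors that determine the damped qubit, so they can be sent
  back. Damping one qubit from each of the two pairs kills \<open>1\<^sub>L\<close> and sends \<open>0\<^sub>L\<close> to a further basis vector,
  which the recovery returns to \<open>0\<^sub>L\<close>. Two orthogonal directions are left over; they are
  sent to \<open>0\<^sub>L\<close> to make the recovery trace preserving. The recovery does not depend on \<open>\<gamma>\<close>.

  With \<open>x\<close> the weight of \<open>0\<^sub>L\<close> in the state, the terms where damping pattern and recovery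
  operator agree contribute \<open>1 - (1 + 3 x - 2 x\<^sup>2) \<gamma>\<^sup>2 + O(\<gamma>\<^sup>3)\<close>, and \<open>1 + 3 x - 2 x\<^sup>2\<close> is at most
  17/8, which is less than 3.
\<close>

section \<open>Kraus maps as quantum operations\<close>

definition kraus_map :: "'i set \<Rightarrow> ('i \<Rightarrow> complex ^ 'n::finite ^ 'm::finite) \<Rightarrow> 'n operator \<Rightarrow> 'm operator" where
  "kraus_map I K X = (\<Sum>i\<in>I. K i ** X ** adjoint (K i))"

lemma adjoint_nth [simp]: "adjoint A $ i $ j = cnj (A $ j $ i)"
  by (simp add: adjoint_def map_matrix_def transpose_def)

lemma braket_adjoint: "braket x (A *v y) = braket (adjoint A *v x) y"
proof -
  have "braket x (A *v y) = (\<Sum>i\<in>UNIV. \<Sum>j\<in>UNIV. cnj (x $ i) * A $ i $ j * y $ j)"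
    by (simp add: braket_def matrix_vector_mult_def sum_distrib_left mult_ac)
  also have "\<dots> = (\<Sum>j\<in>UNIV. \<Sum>i\<in>UNIV. cnj (x $ i) * A $ i $ j * y $ j)"
    by (rule sum.swap)
  also have "\<dots> = braket (adjoint A *v x) y"
    by (simp add: braket_def matrix_vector_mult_def sum_distrib_left sum_distrib_right mult_ac)
  finally show ?thesis .
qed

lemma braket_add_right: "braket x (y + z) = braket x y + braket x z"
  by (simp add: braket_def algebra_simps sum.distrib)

lemma braket_add_left: "braket (x + y) z = braket x z + braket y z"
  by (simp add: braket_def algebra_simps sum.distrib)

lemma braket_0_left [simp]: "braket 0 x = 0"
  by (simp add: braket_def)

lemma braket_scale_right: "braket x (c *s y) = c * braket x y"
  by (simp add: braket_def sum_distrib_left mult_ac)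

lemma braket_scale_left: "braket (c *s x) y = cnj c * braket x y"
  by (simp add: braket_def sum_distrib_left mult_ac)

lemma braket_ket_left [simp]: "braket (ket p) x = x $ p"
proof -
  have "braket (ket p) x = (\<Sum>i\<in>UNIV. if i = p then x $ i else 0)"
    unfolding braket_def by (rule sum.cong) (auto simp: axis_def)
  thus ?thesis by simp
qed

lemma braket_sum_right: "braket x (\<Sum>i\<in>I. f i) = (\<Sum>i\<in>I. braket x (f i))"
proof -
  have "braket x (\<Sum>i\<in>I. f i) = (\<Sum>j\<in>UNIV. \<Sum>i\<in>I. cnj (x $ j) * f i $ j)"
    by (simp add: braket_def sum_distrib_left)
  also have "\<dots> = (\<Sum>i\<in>I. braket x (f i))"
    unfolding braket_def by (rule sum.swap)
  finally show ?thesis .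
qed

lemma ketbra_mult_vec: "ketbra x y *v z = braket y z *s x"
  by (simp add: vec_eq_iff matrix_vector_mult_def ketbra_def braket_def sum_distrib_left sum_distrib_right mult_ac)

lemma sum_matrix_vector_mult: "(\<Sum>i\<in>I. A i) *v x = (\<Sum>i\<in>I. A i *v x)"
  for A :: "'i \<Rightarrow> complex ^ 'n ^ 'm"
  by (induction I rule: infinite_finite_induct) (simp_all add: matrix_vector_mult_add_rdistrib)

lemma matrix_mult_add_left: "(A + B) ** X = A ** X + B ** X"
  for A :: "complex ^ 'n ^ 'm"
  by (simp add: vec_eq_iff matrix_matrix_mult_def distrib_right sum.distrib)

lemma cscale_mult_left: "A ** cscale c X = cscale c (A ** X)"
  by (simp add: vec_eq_iff cscale_def matrix_matrix_mult_def sum_distrib_left mult_ac)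

lemma cscale_mult_right: "cscale c X ** A = cscale c (X ** A)"
  by (simp add: vec_eq_iff cscale_def matrix_matrix_mult_def sum_distrib_left mult_ac)

lemma cscale_sum: "cscale c (\<Sum>i\<in>I. f i) = (\<Sum>i\<in>I. cscale c (f i))"
  by (simp add: vec_eq_iff cscale_def sum_distrib_left)

text \<open>Each \<open>K i\<close> moves onto the left vector as its adjoint, leaving brackets of
  \<open>X\<close> itself; positivity and fidelity both start from this form.\<close>

lemma braket_kraus_map:
  "braket x (kraus_map I K X *v y) =
     (\<Sum>i\<in>I. braket (adjoint (K i) *v x) (X *v (adjoint (K i) *v y)))"
  by (simp add: kraus_map_def sum_matrix_vector_mult braket_sum_right
      matrix_vector_mul_assoc[symmetric] braket_adjoint[of x])

lemma complex_linear_kraus_map: "complex_linear (kraus_map I K)"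
proof -
  interpret vector_space "cscale :: complex \<Rightarrow> 'a operator \<Rightarrow> 'a operator"
    by (rule vector_space_cscale)
  interpret V: vector_space "cscale :: complex \<Rightarrow> 'b operator \<Rightarrow> 'b operator"
    by (rule vector_space_cscale)
  have "Vector_Spaces.linear cscale cscale (kraus_map I K)"
    by unfold_locales
      (simp_all add: kraus_map_def cscale_mult_left cscale_mult_right cscale_sum
        matrix_add_ldistrib matrix_mult_add_left sum.distrib)
  thus ?thesis by (simp add: complex_linear_def)
qed

text \<open>For each \<open>l\<close>, the block form of the output at \<open>v\<close> is that of
  the input at the vectors \<open>adjoint (K l) *v v i\<close>, so every summand is
  nonnegative.\<close>

lemma completely_positive_kraus_map: "completely_positive (kraus_map I K)"
  unfolding completely_positive_def block_positive_def
proof (intro allI impI)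
  fix k and X :: "nat \<Rightarrow> nat \<Rightarrow> 'a operator" and v :: "nat \<Rightarrow> complex ^ 'b"
  assume pos: "\<forall>w. 0 \<le> (\<Sum>i<k. \<Sum>j<k. braket (w i) (X i j *v w j))"
  have "(\<Sum>i<k. \<Sum>j<k. braket (v i) (kraus_map I K (X i j) *v v j)) =
    (\<Sum>i<k. \<Sum>j<k. \<Sum>l\<in>I. braket (adjoint (K l) *v v i) (X i j *v (adjoint (K l) *v v j)))"
    by (simp add: braket_kraus_map)
  also have "\<dots> = (\<Sum>l\<in>I. \<Sum>i<k. \<Sum>j<k. braket (adjoint (K l) *v v i) (X i j *v (adjoint (K l) *v v j)))"
    by (simp only: sum.swap[where B = I])
  also have "0 \<le> \<dots>"
    by (rule sum_nonneg) (rule pos[THEN spec, of "\<lambda>i. adjoint (K _) *v v i"])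
  finally show "0 \<le> (\<Sum>i<k. \<Sum>j<k. braket (v i) (kraus_map I K (X i j) *v v j))" .
qed

lemma trace_sum: "trace (\<Sum>i\<in>I. f i) = (\<Sum>i\<in>I. trace (f i))"
  for f :: "'i \<Rightarrow> complex ^ 'n ^ 'n"
  by (simp add: trace_def sum.swap[where B = I])

lemma sum_matrix_mult_right: "(\<Sum>i\<in>I. A i) ** X = (\<Sum>i\<in>I. A i ** X)"
  for A :: "'i \<Rightarrow> complex ^ 'n ^ 'm"
  by (induction I rule: infinite_finite_induct) (simp_all add: matrix_mult_add_left)

text \<open>Cyclicity of the trace brings the adjoint to the front, where the completeness relation
  collapses the sum to the identity.\<close>

lemma tp_quantum_operation_kraus_map:
  assumes "(\<Sum>i\<in>I. adjoint (K i) ** K i) = mat 1"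
  shows "tp_quantum_operation (kraus_map I K)"
proof -
  have "trace (kraus_map I K X) = trace X" for X
  proof -
    have "trace (kraus_map I K X) = (\<Sum>i\<in>I. trace (adjoint (K i) ** (K i ** X)))"
      by (simp add: kraus_map_def trace_sum trace_mul_sym[of "adjoint _"])
    also have "\<dots> = trace ((\<Sum>i\<in>I. adjoint (K i) ** K i) ** X)"
      by (simp add: sum_matrix_mult_right trace_sum matrix_mul_assoc)
    finally show ?thesis by (simp add: assms)
  qed
  thus ?thesis
    by (simp add: tp_quantum_operation_def trace_preserving_def complex_linear_kraus_map
        completely_positive_kraus_map)
qed

section \<open>Fidelity as a sum of squared amplitudes\<close>

lemma braket_cnj: "cnj (braket x y) = braket y x"
  by (simp add: braket_def mult_ac)

text \<open>On a rank-one input each Kraus term is the squared modulus of one amplitude; the outer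
  operators are absorbed into \<open>x\<close>. As all terms are nonnegative, a lower bound may keep
  only some of them.\<close>

lemma braket_kraus_map_ketbra:
  "braket x (kraus_map J L (kraus_map I K (ketbra y y)) *v x) =
     (\<Sum>j\<in>J. \<Sum>i\<in>I. complex_of_real ((cmod (braket (adjoint (L j) *v x) (K i *v y)))\<^sup>2))"
proof -
  have "braket z (kraus_map I K (ketbra y y) *v z) =
      (\<Sum>i\<in>I. complex_of_real ((cmod (braket z (K i *v y)))\<^sup>2))" for z
    unfolding braket_kraus_map ketbra_mult_vec braket_scale_right complex_norm_square braket_adjoint[of z] braket_cnj
    by (simp only: mult.commute)
  thus ?thesis by (simp add: braket_kraus_map[of _ J])
qed

section \<open>Tensor products of Kraus maps\<close>

lemma matrix_conj_nth:
  "(K ** X ** adjoint K) $ a $ b = (\<Sum>p\<in>UNIV. \<Sum>q\<in>UNIV. X $ p $ q * (K $ a $ p * cnj (K $ b $ q)))"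
proof -
  have "(K ** X ** adjoint K) $ a $ b = (\<Sum>q\<in>UNIV. \<Sum>p\<in>UNIV. X $ p $ q * (K $ a $ p * cnj (K $ b $ q)))"
    by (simp add: matrix_matrix_mult_def sum_distrib_left sum_distrib_right mult_ac)
  thus ?thesis by (subst sum.swap)
qed

lemma kraus_map_matrix_unit:
  "kraus_map I K (ketbra (ket p) (ket q)) $ a $ b = (\<Sum>i\<in>I. K i $ a $ p * cnj (K i $ b $ q))"
proof -
  have "(K i ** ketbra (ket p) (ket q) ** adjoint (K i)) $ a $ b = K i $ a $ p * cnj (K i $ b $ q)" for i
  proof -
    have "(\<Sum>r\<in>UNIV. \<Sum>s\<in>UNIV. ketbra (ket p) (ket q) $ r $ s * (K i $ a $ r * cnj (K i $ b $ s)))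
      = (\<Sum>r\<in>UNIV. \<Sum>s\<in>UNIV. if s = q then (if r = p then K i $ a $ r * cnj (K i $ b $ s) else 0) else 0)"
      by (intro sum.cong refl) (auto simp: ketbra_def axis_def)
    thus ?thesis by (simp add: matrix_conj_nth)
  qed
  thus ?thesis by (simp add: kraus_map_def)
qed

text \<open>Entries of a tensor product factor, so the product of the sums over \<open>I\<close> and
  \<open>J\<close> is one sum over \<open>I \<times> J\<close>, which is then exchanged with the
  matrix sums.\<close>

lemma tensor_map_kraus_map:
  "tensor_map (kraus_map I K) (kraus_map J L) =
     kraus_map (I \<times> J) (\<lambda>(i, j). tensor_op (K i) (L j))"
proof (intro ext)
  fix X
  have "tensor_map (kraus_map I K) (kraus_map J L) X $ a $ b =
     kraus_map (I \<times> J) (\<lambda>(i, j). tensor_op (K i) (L j)) X $ a $ b" for a b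
  proof -
    let ?t = "\<lambda>i j p q. X $ p $ q * (tensor_op (K i) (L j) $ a $ p * cnj (tensor_op (K i) (L j) $ b $ q))"
    have "tensor_map (kraus_map I K) (kraus_map J L) X $ a $ b =
        (\<Sum>p\<in>UNIV. \<Sum>q\<in>UNIV. X $ p $ q *
          (kraus_map I K (ketbra (ket (fst p)) (ket (fst q))) $ fst a $ fst b *
           kraus_map J L (ketbra (ket (snd p)) (ket (snd q))) $ snd a $ snd b))"
      by (simp add: tensor_map_def cscale_def tensor_op_def)
    also have "\<dots> = (\<Sum>p\<in>UNIV. \<Sum>q\<in>UNIV. \<Sum>i\<in>I. \<Sum>j\<in>J. ?t i j p q)"
      unfolding kraus_map_matrix_unit sum_product unfolding sum_distrib_left
      by (intro sum.cong refl) (simp add: tensor_op_def)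
    also have "\<dots> = (\<Sum>p\<in>UNIV. \<Sum>q\<in>UNIV. \<Sum>m\<in>I \<times> J. ?t (fst m) (snd m) p q)"
      by (simp add: sum.cartesian_product')
    also have "\<dots> = (\<Sum>m\<in>I \<times> J. \<Sum>p\<in>UNIV. \<Sum>q\<in>UNIV. ?t (fst m) (snd m) p q)"
      by (simp only: sum.swap[where B = "I \<times> J"])
    also have "\<dots> = kraus_map (I \<times> J) (\<lambda>(i, j). tensor_op (K i) (L j)) X $ a $ b"
      by (simp add: kraus_map_def matrix_conj_nth split_def)
    finally show ?thesis .
  qed
  thus "tensor_map (kraus_map I K) (kraus_map J L) X =
     kraus_map (I \<times> J) (\<lambda>(i, j). tensor_op (K i) (L j)) X"
    by (simp add: vec_eq_iff)
qed

section \<open>The fourfold damping in Kraus form\<close>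

definition damp_kraus :: "real \<Rightarrow> bool \<Rightarrow> bool operator" where
  "damp_kraus \<gamma> i = (if i then damp_A1 \<gamma> else damp_A0 \<gamma>)"

text \<open>\<open>True\<close> marks a damped qubit. The pairs are nested as in
  \<open>amp_damp4\<close>, so the patterns fill the type \<open>qubits4\<close>.\<close>

definition damp_kraus4 :: "real \<Rightarrow> qubits4 \<Rightarrow> qubits4 operator" where
  "damp_kraus4 \<gamma> = (\<lambda>(i, j, k, l).
     tensor_op (damp_kraus \<gamma> i) (tensor_op (damp_kraus \<gamma> j) (tensor_op (damp_kraus \<gamma> k) (damp_kraus \<gamma> l))))"

lemma amp_damp4_eq_kraus_map: "amp_damp4 \<gamma> = kraus_map UNIV (damp_kraus4 \<gamma>)"
proof -
  have "amp_damp \<gamma> = kraus_map UNIV (damp_kraus \<gamma>)"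
    by (simp add: fun_eq_iff amp_damp_def kraus_map_def UNIV_bool damp_kraus_def)
  thus ?thesis
    by (simp add: amp_damp4_def tensor_map_kraus_map damp_kraus4_def split_def)
qed

lemma sum_qubits4:
  "(\<Sum>p\<in>(UNIV :: qubits4 set). f p) = (\<Sum>i\<in>UNIV. \<Sum>j\<in>UNIV. \<Sum>k\<in>UNIV. \<Sum>l\<in>UNIV. f (i, j, k, l))"
  by (simp only: UNIV_Times_UNIV[symmetric] sum.cartesian_product')

section \<open>The code basis\<close>

lemma inverse_sqrt2_mult: "complex_of_real (1 / sqrt 2) * complex_of_real (1 / sqrt 2) = 1 / 2"
  by (simp flip: of_real_mult)

lemma braket_zero_L: "braket zero_L x = complex_of_real (1 / sqrt 2) * (x $ (False, False, False, False) + x $ (True, True, True, True))"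
  by (simp add: zero_L_def braket_scale_left braket_add_left add_divide_distrib)

lemma braket_one_L: "braket one_L x = complex_of_real (1 / sqrt 2) * (x $ (False, False, True, True) + x $ (True, True, False, False))"
  by (simp add: one_L_def braket_scale_left braket_add_left add_divide_distrib)

lemma code_orthonormal:
  "braket zero_L zero_L = 1" "braket one_L one_L = 1"
  "braket zero_L one_L = 0" "braket one_L zero_L = 0"
  unfolding braket_zero_L braket_one_L
  by (simp_all add: zero_L_def one_L_def axis_def field_simps flip: of_real_mult)

section \<open>The recovery operators and their completeness\<close>

text \<open>
  The recovery operator for pattern \<open>m\<close> maps \<open>recovery_zero m\<close> to \<open>0\<^sub>L\<close> and \<open>recovery_one m\<close>
  to \<open>1\<^sub>L\<close>. The patterns damping both qubits of a pair serve as labels for the two left-over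
  directions.
\<close>

fun recovery_zero :: "qubits4 \<Rightarrow> complex ^ qubits4" where
  "recovery_zero (False, False, False, False) = zero_L"
| "recovery_zero (True, False, False, False) = ket (False, True, True, True)"
| "recovery_zero (False, True, False, False) = ket (True, False, True, True)"
| "recovery_zero (False, False, True, False) = ket (True, True, False, True)"
| "recovery_zero (False, False, False, True) = ket (True, True, True, False)"
| "recovery_zero (True, False, True, False) = ket (False, True, False, True)"
| "recovery_zero (True, False, False, True) = ket (False, True, True, False)"
| "recovery_zero (False, True, True, False) = ket (True, False, False, True)"
| "recovery_zero (False, True, False, True) = ket (True, False, True, False)"
| "recovery_zero (True, True, False, False) = complex_of_real (1 / sqrt 2) *s
     (ket (False, False, False, False) - ket (True, True, True, True))"
| "recovery_zero (False, False, True, True) = complex_of_real (1 / sqrt 2) *s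
     (ket (False, False, True, True) - ket (True, True, False, False))"
| "recovery_zero _ = 0"

fun recovery_one :: "qubits4 \<Rightarrow> complex ^ qubits4" where
  "recovery_one (False, False, False, False) = one_L"
| "recovery_one (True, False, False, False) = ket (False, True, False, False)"
| "recovery_one (False, True, False, False) = ket (True, False, False, False)"
| "recovery_one (False, False, True, False) = ket (False, False, False, True)"
| "recovery_one (False, False, False, True) = ket (False, False, True, False)"
| "recovery_one _ = 0"

definition recovery_kraus :: "qubits4 \<Rightarrow> qubits4 operator" where
  "recovery_kraus m = ketbra zero_L (recovery_zero m) + ketbra one_L (recovery_one m)"

lemma adjoint_ketbra: "adjoint (ketbra x y) = ketbra y x"
  by (simp add: vec_eq_iff ketbra_def)

lemma adjoint_add: "adjoint (A + B) = adjoint A + adjoint B"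
  by (simp add: vec_eq_iff)

lemma ketbra_mult_ketbra: "ketbra x y ** ketbra z w = cscale (braket y z) (ketbra x w)"
  by (simp add: vec_eq_iff ketbra_def matrix_matrix_mult_def cscale_def braket_def
      sum_distrib_left sum_distrib_right mult_ac)

lemma cscale_0 [simp]: "cscale 0 A = 0" and cscale_1 [simp]: "cscale 1 A = A"
  by (simp_all add: vec_eq_iff cscale_def)

lemma adjoint_recovery_kraus_mult:
  "adjoint (recovery_kraus m) ** recovery_kraus m =
     ketbra (recovery_zero m) (recovery_zero m) + ketbra (recovery_one m) (recovery_one m)"
  by (simp add: recovery_kraus_def adjoint_add adjoint_ketbra matrix_add_ldistrib
      matrix_mult_add_left ketbra_mult_ketbra code_orthonormal)

text \<open>The cross terms cancel. This trades a code word and its left-over direction for the two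
  kets that span them.\<close>

lemma ketbra_sum_diff:
  "ketbra (complex_of_real (1 / sqrt 2) *s (x + y)) (complex_of_real (1 / sqrt 2) *s (x + y)) +
   ketbra (complex_of_real (1 / sqrt 2) *s (x - y)) (complex_of_real (1 / sqrt 2) *s (x - y)) =
   ketbra x x + ketbra y y"
  by (simp add: vec_eq_iff ketbra_def inverse_sqrt2_mult algebra_simps del: of_real_divide)

lemma sum_ketbra_ket: "(\<Sum>p\<in>UNIV. ketbra (ket p) (ket p)) = mat 1"
proof -
  have "(\<Sum>p\<in>UNIV. ketbra (ket p) (ket p)) $ i $ j = mat 1 $ i $ j" for i j :: 'a
  proof -
    have "(\<Sum>p\<in>UNIV. ketbra (ket p) (ket p)) $ i $ j = (\<Sum>p\<in>UNIV. if p = i then if i = j then 1 else 0 else 0)"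
      unfolding sum_component by (intro sum.cong refl) (auto simp: ketbra_def axis_def)
    thus ?thesis by (simp add: mat_def)
  qed
  thus ?thesis by (simp add: vec_eq_iff)
qed

text \<open>Single dampings supply the eight kets of odd weight, double ones the four with one
  excitation in each pair; the code words and left-over directions account for the other
  four.\<close>

lemma recovery_kraus_complete: "(\<Sum>m\<in>UNIV. adjoint (recovery_kraus m) ** recovery_kraus m) = mat 1"
proof -
  let ?P = "\<lambda>x :: complex ^ qubits4. ketbra x x"
  have zero: "?P zero_L + ?P (recovery_zero (True, True, False, False)) =
      ?P (ket (False, False, False, False)) + ?P (ket (True, True, True, True))"
    and one: "?P one_L + ?P (recovery_zero (False, False, True, True)) =
      ?P (ket (False, False, True, True)) + ?P (ket (True, True, False, False))"
    unfolding zero_L_def one_L_def recovery_zero.simps by (rule ketbra_sum_diff)+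
  have null: "?P 0 = 0" by (simp add: vec_eq_iff ketbra_def)
  \<comment> \<open>\<open>zero\<close> and \<open>one\<close> are solved for the left-over
    projectors, so that the code projectors cancel; removing two equations of
    \<open>recovery_zero\<close> keeps these rules applicable.\<close>
  have "(\<Sum>m\<in>UNIV. adjoint (recovery_kraus m) ** recovery_kraus m) = (\<Sum>p\<in>UNIV. ?P (ket p))"
    by (simp add: adjoint_recovery_kraus_mult sum_qubits4 UNIV_bool null
        eq_diff_eq[THEN iffD2, OF zero[unfolded add.commute[of "?P zero_L"]]]
        eq_diff_eq[THEN iffD2, OF one[unfolded add.commute[of "?P one_L"]]]
        del: recovery_zero.simps(10,11))
  thus ?thesis by (simp add: sum_ketbra_ket)
qed

section \<open>Amplitudes of matching damping and recovery patterns\<close>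

lemma adjoint_recovery_kraus_vec:
  "adjoint (recovery_kraus m) *v (a *s zero_L + b *s one_L) = a *s recovery_zero m + b *s recovery_one m"
  by (simp add: recovery_kraus_def adjoint_add adjoint_ketbra matrix_vector_mult_add_rdistrib
     ketbra_mult_vec braket_add_right braket_scale_right code_orthonormal)

lemma braket_self: "braket x x = complex_of_real ((norm x)\<^sup>2)"
proof -
  have "(norm x)\<^sup>2 = (\<Sum>i\<in>UNIV. (cmod (x $ i))\<^sup>2)"
    by (simp only: power2_norm_eq_inner inner_vec_def)
  thus ?thesis
    by (simp only: braket_def of_real_sum complex_norm_square mult.commute)
qed

lemma norm_sq_code:
  assumes "norm (a *s zero_L + b *s one_L) = 1"
  shows "(cmod a)\<^sup>2 + (cmod b)\<^sup>2 = 1"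
proof -
  let ?x = "a *s zero_L + b *s one_L"
  have "braket ?x ?x = complex_of_real ((norm ?x)\<^sup>2)"
    by (rule braket_self)
  moreover have "braket ?x ?x = complex_of_real ((cmod a)\<^sup>2 + (cmod b)\<^sup>2)"
    by (simp add: braket_add_left braket_add_right braket_scale_left braket_scale_right code_orthonormal
       complex_norm_square mult.commute del: of_real_power)
  ultimately show ?thesis using assms by (metis of_real_eq_iff one_power2)
qed

lemma mult_ket_nth: "(A *v ket q) $ p = A $ p $ q" for A :: "complex ^ 'n ^ 'm"
proof -
  have "(A *v ket q) $ p = (\<Sum>j\<in>UNIV. if j = q then A $ p $ j else 0)"
    unfolding matrix_vector_mult_def vec_lambda_beta
    by (intro sum.cong refl) (auto simp: axis_def)
  thus ?thesis by simp
qed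

lemma mult_code_nth:
  fixes A :: "qubits4 operator"
  shows "(A *v (a *s zero_L + b *s one_L)) $ p = complex_of_real (1 / sqrt 2) *
     (a * (A $ p $ (False, False, False, False) + A $ p $ (True, True, True, True)) +
      b * (A $ p $ (False, False, True, True) + A $ p $ (True, True, False, False)))"
  by (simp add: zero_L_def one_L_def matrix_vector_right_distrib vector_scalar_commute
     mult_ket_nth algebra_simps)

text \<open>Each surviving excitation contributes \<open>sqrt (1 - \<gamma>)\<close> and each lost
  one \<open>sqrt \<gamma>\<close>. A pattern acts only on kets excited at all its damped qubits, so
  a double one sees just the ket of weight four.\<close>

lemma code_amplitudes:
  fixes a b :: complex and \<gamma> :: real
  assumes \<gamma>: "0 \<le> \<gamma>" "\<gamma> \<le> 1"
  defines "x \<equiv> (cmod a)\<^sup>2" and "y \<equiv> (cmod b)\<^sup>2"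
    and "\<psi> \<equiv> a *s zero_L + b *s one_L"
  defines "amp \<equiv> \<lambda>m. braket (adjoint (recovery_kraus m) *v \<psi>) (damp_kraus4 \<gamma> m *v \<psi>)"
  shows "amp (False, False, False, False) = complex_of_real (x * (1 + (1 - \<gamma>)\<^sup>2) / 2 + y * (1 - \<gamma>))"
    and "m \<in> {(True, False, False, False), (False, True, False, False), (False, False, True, False), (False, False, False, True)} \<Longrightarrow>
     amp m = complex_of_real (1 / sqrt 2 * sqrt \<gamma> * sqrt (1 - \<gamma>) * (x * (1 - \<gamma>) + y))"
    and "m \<in> {(True, False, True, False), (True, False, False, True), (False, True, True, False), (False, True, False, True)} \<Longrightarrow>
     amp m = complex_of_real (1 / sqrt 2 * \<gamma> * (1 - \<gamma>) * x)"
proof -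
  define r t g :: complex
    where "r = complex_of_real (1 / sqrt 2)" and "t = complex_of_real (sqrt (1 - \<gamma>))"
      and "g = complex_of_real (sqrt \<gamma>)"
  \<comment> \<open>Expressing \<open>\<gamma>\<close> and \<open>g * g\<close> through
    \<open>t\<close> turns the claims into polynomial identities.\<close>
  have \<gamma>t: "complex_of_real \<gamma> = 1 - t * t" and gg: "g * g = 1 - t * t" and rr: "r * r = 1 / 2"
    using \<gamma> unfolding r_def t_def g_def by (simp_all add: inverse_sqrt2_mult flip: of_real_mult)
  have g: "g * (g * u) = (1 - t * t) * u" for u
    by (simp add: gg flip: mult.assoc)
  have x: "complex_of_real x = a * cnj a" and y: "complex_of_real y = b * cnj b"
    by (simp_all only: x_def y_def complex_norm_square)
  note amp = amp_def \<psi>_def adjoint_recovery_kraus_vec braket_add_left braket_scale_left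
    recovery_zero.simps recovery_one.simps braket_ket_left braket_zero_L braket_one_L mult_code_nth
    r_def[symmetric] damp_kraus4_def tensor_op_def damp_kraus_def damp_A0_def damp_A1_def qubit_matrix_def
    t_def[symmetric] g_def[symmetric] x y
  show "amp (False, False, False, False) = complex_of_real (x * (1 + (1 - \<gamma>)\<^sup>2) / 2 + y * (1 - \<gamma>))"
    unfolding of_real_add of_real_divide of_real_mult of_real_diff of_real_power of_real_1 of_real_numeral
    by (simp add: amp \<gamma>t del: of_real_divide) (use rr in algebra)
  show "amp m = complex_of_real (1 / sqrt 2 * sqrt \<gamma> * sqrt (1 - \<gamma>) * (x * (1 - \<gamma>) + y))"
    if "m \<in> {(True, False, False, False), (False, True, False, False), (False, False, True, False), (False, False, False, True)}"
    unfolding of_real_mult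
    using that by (auto simp: amp \<gamma>t g rr ring_distribs mult_ac simp del: of_real_divide)
  show "amp m = complex_of_real (1 / sqrt 2 * \<gamma> * (1 - \<gamma>) * x)"
    if "m \<in> {(True, False, True, False), (True, False, False, True), (False, True, True, False), (False, True, False, True)}"
    unfolding of_real_mult
    using that by (auto simp: amp \<gamma>t g rr ring_distribs mult_ac simp del: of_real_divide)
qed

section \<open>The polynomial estimate\<close>

lemma fidelity_bound:
  fixes x \<gamma> :: real
  assumes "0 \<le> x" "x \<le> 1" "0 < \<gamma>" "\<gamma> < 1 / 4"
  shows "1 - 3 * \<gamma>\<^sup>2 \<le> (x * (1 + (1 - \<gamma>)\<^sup>2) / 2 + (1 - x) * (1 - \<gamma>))\<^sup>2
    + 4 * (\<gamma> * (1 - \<gamma>) / 2 * (x * (1 - \<gamma>) + (1 - x))\<^sup>2)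
    + 4 * (\<gamma>\<^sup>2 * (1 - \<gamma>)\<^sup>2 / 2 * x\<^sup>2)"
proof -
  \<comment> \<open>The constant and linear terms in \<open>\<gamma>\<close> cancel. Completing the
    square in the leading coefficient \<open>2 - 3 * x + 2 * x\<^sup>2\<close> leaves 7/8 to absorb
    the only negative term.\<close>
  have "(x * (1 + (1 - \<gamma>)\<^sup>2) / 2 + (1 - x) * (1 - \<gamma>))\<^sup>2
    + 4 * (\<gamma> * (1 - \<gamma>) / 2 * (x * (1 - \<gamma>) + (1 - x))\<^sup>2)
    + 4 * (\<gamma>\<^sup>2 * (1 - \<gamma>)\<^sup>2 / 2 * x\<^sup>2) - (1 - 3 * \<gamma>\<^sup>2)
    = \<gamma>\<^sup>2 * (2 * (x - 3/4)\<^sup>2 + (7/8 - 2 * \<gamma> * x\<^sup>2) + 3 * \<gamma> * x + x\<^sup>2 * \<gamma>\<^sup>2 / 4)"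
    by (simp add: power2_eq_square field_simps)
  moreover have "2 * \<gamma> * x\<^sup>2 \<le> 7 / 8"
    using mult_mono[of "2 * \<gamma>" "1 / 2" "x\<^sup>2" 1] assms by (simp add: power_le_one)
  ultimately show ?thesis
    using assms
    by (smt (verit) mult_nonneg_nonneg zero_le_power2 divide_nonneg_nonneg)
qed

section \<open>Assembling the fidelity bound\<close>

theorem mainTheorem2:
  shows "\<exists>\<gamma>\<^sub>0 > 0. \<forall>\<gamma>::real. 0 < \<gamma> \<and> \<gamma> < 1 \<and> \<gamma> < \<gamma>\<^sub>0 \<longrightarrow>
    (\<exists>R :: qubits4 operator \<Rightarrow> qubits4 operator.
       tp_quantum_operation R \<and>
       (\<forall>\<psi> \<in> damping_code. norm \<psi> = 1 \<longrightarrow>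
          braket \<psi> (R (amp_damp4 \<gamma> (ketbra \<psi> \<psi>)) *v \<psi>)
            \<ge> complex_of_real (1 - 3 * \<gamma>\<^sup>2)))"
\<comment> \<open>The threshold is the one under which \<open>fidelity_bound\<close> holds; one
  recovery serves every \<open>\<gamma>\<close>.\<close>
proof (rule exI[of _ "1 / 4"], intro conjI allI impI exI[of _ "kraus_map UNIV recovery_kraus"] ballI)
  show "(0::real) < 1 / 4" by simp
  show "tp_quantum_operation (kraus_map UNIV recovery_kraus)"
    by (rule tp_quantum_operation_kraus_map[OF recovery_kraus_complete])
  fix \<gamma> :: real and \<psi> :: "complex ^ qubits4"
  assume \<gamma>: "0 < \<gamma> \<and> \<gamma> < 1 \<and> \<gamma> < 1 / 4" and code: "\<psi> \<in> damping_code" and norm: "norm \<psi> = 1"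
  from code obtain a b where "\<psi> - a *s zero_L - b *s one_L = 0"
    by (auto simp: damping_code_def vec.span_breakdown_eq)
  hence \<psi>: "\<psi> = a *s zero_L + b *s one_L" by (simp add: algebra_simps)
  let ?amp = "\<lambda>m n. braket (adjoint (recovery_kraus m) *v \<psi>) (damp_kraus4 \<gamma> n *v \<psi>)"
  define x where "x = (cmod a)\<^sup>2"
  have y: "(cmod b)\<^sup>2 = 1 - x"
    using norm_sq_code[of a b] norm unfolding \<psi> x_def by simp
  have x: "0 \<le> x" "x \<le> 1"
    using zero_le_power2[of "cmod b"] unfolding y by (simp_all add: x_def)
  have \<gamma>': "0 \<le> \<gamma>" "\<gamma> \<le> 1" using \<gamma> by auto
  note amps = code_amplitudes[OF \<gamma>', where a = a and b = b, folded \<psi> x_def, unfolded y]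
  let ?single = "{(True, False, False, False), (False, True, False, False),
    (False, False, True, False), (False, False, False, True)} :: qubits4 set"
  let ?double = "{(True, False, True, False), (True, False, False, True),
    (False, True, True, False), (False, True, False, True)} :: qubits4 set"
  have none: "(cmod (?amp (False, False, False, False) (False, False, False, False)))\<^sup>2 =
      (x * (1 + (1 - \<gamma>)\<^sup>2) / 2 + (1 - x) * (1 - \<gamma>))\<^sup>2"
    by (simp only: amps norm_of_real power2_abs)
  have single: "(cmod (?amp m m))\<^sup>2 = \<gamma> * (1 - \<gamma>) / 2 * (x * (1 - \<gamma>) + (1 - x))\<^sup>2" if "m \<in> ?single" for m
    unfolding amps(2)[OF that] norm_of_real power2_abs
    using \<gamma> by (simp add: power_mult_distrib power_divide)
  have double: "(cmod (?amp m m))\<^sup>2 = \<gamma>\<^sup>2 * (1 - \<gamma>)\<^sup>2 / 2 * x\<^sup>2" if "m \<in> ?double" for m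
    unfolding amps(3)[OF that] norm_of_real power2_abs
    by (simp add: power_mult_distrib power_divide)
  have "1 - 3 * \<gamma>\<^sup>2 \<le> (cmod (?amp (False, False, False, False) (False, False, False, False)))\<^sup>2
      + (\<Sum>m\<in>?single. (cmod (?amp m m))\<^sup>2) + (\<Sum>m\<in>?double. (cmod (?amp m m))\<^sup>2)"
    using fidelity_bound[OF x, of \<gamma>] \<gamma> by (simp add: none single double)
  also have "\<dots> = (\<Sum>m\<in>insert (False, False, False, False) (?single \<union> ?double). (cmod (?amp m m))\<^sup>2)"
    by simp
  \<comment> \<open>Squares are added back: first the remaining matching patterns, then the pairs
    where recovery and damping patterns differ.\<close>
  also have "\<dots> \<le> (\<Sum>m\<in>UNIV. (cmod (?amp m m))\<^sup>2)"
    by (rule sum_mono2) auto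
  also have "\<dots> \<le> (\<Sum>m\<in>UNIV. \<Sum>n\<in>UNIV. (cmod (?amp m n))\<^sup>2)"
    by (intro sum_mono member_le_sum) auto
  \<comment> \<open>Both sides are real, so the order on complex numbers reduces to the real
    one.\<close>
  finally have "complex_of_real (1 - 3 * \<gamma>\<^sup>2) \<le> complex_of_real (\<Sum>m\<in>UNIV. \<Sum>n\<in>UNIV. (cmod (?amp m n))\<^sup>2)"
    by (simp only: less_eq_complex_def Re_complex_of_real Im_complex_of_real)
  thus "complex_of_real (1 - 3 * \<gamma>\<^sup>2) \<le>
      braket \<psi> (kraus_map UNIV recovery_kraus (amp_damp4 \<gamma> (ketbra \<psi> \<psi>)) *v \<psi>)"
    by (simp only: amp_damp4_eq_kraus_map braket_kraus_map_ketbra of_real_sum)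
qed

end
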